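(* Let $0<q_1<p<q_2<\infty$ and $p_1=p_2=p$. Assume that $v_1,v_2\in\mathcal W(0,\infty)$, $u_1\in{}^{\mathbf c}\Omega_{q_1}$ and $u_2\in\Omega_{q_2}$, and put $v(x)=v_1(x)^{-1}v_2(x)$. Then $$\|\mathrm I\|_{\mathrm{Cop}_{p_1,q_1}(u_1,v_1)\to\mathrm{Ces}_{p_2,q_2}(u_2,v_2)}\approx\sup_{t\in(0,\infty)}\Big\|\,\|u_1\|_{q_1,(0,\cdot)}^{-1}\Big\|_{\infty,v,(0,t)}\|u_2\|_{q_2,(t,\infty)}.$$
   Context: $\mathfrak M^+(0,\infty)$ is the set of non-negative measurable functions on $(0,\infty)$; $\mathcal W(0,\infty)$ is the set of weights (measurable functions, positive and finite a.e. on $(0,\infty)$). For $0<p\le\infty$ and measurable $A\subseteq(0,\infty)$, $\|f\|_{p,A}=(\int_A|f|^p\,dx)^{1/p}$ if $p<\infty$, $\|f\|_{\infty,A}=\operatorname{ess\,sup}_A|f|$, and $\|f\|_{p,w,A}=\|fw\|_{p,A}$. Conventions: $0/0=0$, $0\cdot(\pm\infty)=0$, $1/(\pm\infty)=0$. For $u\in\mathfrak M^+(0,\infty)$, $v\in\mathcal W(0,\infty)$ and $0<p,q\le\infty$, $\mathrm{Ces}_{p,q}(u,v)$ and $\mathrm{Cop}_{p,q}(u,v)$ are the sets of $f\in\mathfrak M^+(0,\infty)$ with finite $\|f\|_{\mathrm{Ces}_{p,q}(u,v)}=\big\|\,\|f\|_{p,v,(0,\cdot)}\big\|_{q,u,(0,\infty)}$,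 respectively $\|f\|_{\mathrm{Cop}_{p,q}(u,v)}=\big\|\,\|f\|_{p,v,(\cdot,\infty)}\big\|_{q,u,(0,\infty)}$. $\Omega_q$ is the set of $u\in\mathfrak M^+(0,\infty)$ with $0<\|u\|_{q,(t,\infty)}<\infty$ for all $t>0$; ${}^{\mathbf c}\Omega_q$ is the set of $u\in\mathfrak M^+(0,\infty)$ with $0<\|u\|_{q,(0,t)}<\infty$ for all $t>0$. $\|\mathrm I\|_{X\to Y}$ is the best constant of the embedding $X\hookrightarrow Y$: the least $c\in[0,\infty]$ with $\|f\|_Y\le c\|f\|_X$ for all $f\in X$. $A\approx B$ means $c^{-1}B\le A\le cB$ with a constant $c>0$ depending only on $p,q_1,q_2$. *)

theory Defs
  imports "HOL-Probability.Essential_Supremum"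
begin

text \<open>
  All functions on the half-line are functions of type \<open>real \<Rightarrow> ennreal\<close> of which only the values
  on \<open>{0<..}\<close> matter; measurability, integrals and essential suprema refer to Lebesgue measure on
  subsets of \<open>{0<..}\<close>. The arithmetic of \<open>ennreal\<close> obeys the conventions
  \<open>0 * \<infinity> = 0\<close>, \<open>inverse \<infinity> = 0\<close> and \<open>0 / 0 = 0\<close>.
\<close>

definition mplus :: "(real \<Rightarrow> ennreal) set" where
  "mplus = borel_measurable (lebesgue_on {0<..})"

definition weights :: "(real \<Rightarrow> ennreal) set" where
  "weights = {w \<in> mplus. AE x in lebesgue_on {0<..}. 0 < w x \<and> w x < \<infinity>}"

text \<open>Powers of extended non-negative numbers, only meant for exponents \<open>a > 0\<close>.\<close>

definition epowr :: "ennreal \<Rightarrow> real \<Rightarrow> ennreal" where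
  "epowr x a = (if x = \<infinity> then \<infinity> else ennreal (enn2real x powr a))"

definition lp_norm :: "ennreal \<Rightarrow> real set \<Rightarrow> (real \<Rightarrow> ennreal) \<Rightarrow> ennreal" where
  "lp_norm p A f =
     (if p = \<infinity> then esssup (lebesgue_on A) f
      else epowr (\<integral>\<^sup>+x. epowr (f x) (enn2real p) \<partial>lebesgue_on A) (1 / enn2real p))"

definition wlp_norm :: "ennreal \<Rightarrow> (real \<Rightarrow> ennreal) \<Rightarrow> real set \<Rightarrow> (real \<Rightarrow> ennreal) \<Rightarrow> ennreal" where
  "wlp_norm p w A f = lp_norm p A (\<lambda>x. f x * w x)"

definition ces_norm ::
    "ennreal \<Rightarrow> ennreal \<Rightarrow> (real \<Rightarrow> ennreal) \<Rightarrow> (real \<Rightarrow> ennreal) \<Rightarrow> (real \<Rightarrow> ennreal) \<Rightarrow> ennreal" where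
  "ces_norm p q u v f = wlp_norm q u {0<..} (\<lambda>t. wlp_norm p v {0<..<t} f)"

definition cop_norm ::
    "ennreal \<Rightarrow> ennreal \<Rightarrow> (real \<Rightarrow> ennreal) \<Rightarrow> (real \<Rightarrow> ennreal) \<Rightarrow> (real \<Rightarrow> ennreal) \<Rightarrow> ennreal" where
  "cop_norm p q u v f = wlp_norm q u {0<..} (\<lambda>t. wlp_norm p v {t<..} f)"

definition omega :: "ennreal \<Rightarrow> (real \<Rightarrow> ennreal) set" where
  "omega q = {u \<in> mplus. \<forall>t>0. 0 < lp_norm q {t<..} u \<and> lp_norm q {t<..} u < \<infinity>}"

definition omega_c :: "ennreal \<Rightarrow> (real \<Rightarrow> ennreal) set" where
  "omega_c q = {u \<in> mplus. \<forall>t>0. 0 < lp_norm q {0<..<t} u \<and> lp_norm q {0<..<t} u < \<infinity>}"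

text \<open>
  A function space is given by its functional \<open>N\<close>; it consists of the \<open>f \<in> mplus\<close>
  with \<open>N f < \<infinity>\<close>.
\<close>

definition fspace :: "((real \<Rightarrow> ennreal) \<Rightarrow> ennreal) \<Rightarrow> (real \<Rightarrow> ennreal) set" where
  "fspace N = {f \<in> mplus. N f < \<infinity>}"

text \<open>
  The best constant of the embedding of \<open>fspace NX\<close> into \<open>fspace NY\<close>. The infimum is attained
  whenever some constant in \<open>[0, \<infinity>]\<close> is admissible (lemma \<open>embedding_const_admissible\<close>), hence it
  is the least admissible constant.
\<close>

definition embedding_const ::
    "((real \<Rightarrow> ennreal) \<Rightarrow> ennreal) \<Rightarrow> ((real \<Rightarrow> ennreal) \<Rightarrow> ennreal) \<Rightarrow> ennreal" where
  "embedding_const NX NY = Inf {c. \<forall>f \<in> fspace NX. NY f \<le> c * NX f}"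

lemma embedding_const_admissible:
  assumes c: "\<forall>f \<in> fspace NX. NY f \<le> c * NX f" and f: "f \<in> fspace NX"
  shows "NY f \<le> embedding_const NX NY * NX f"
proof (cases "NX f = 0")
  case True
  with c f show ?thesis by force
next
  case False
  have fin: "NX f < top" using f by (simp add: fspace_def)
  have "NY f / NX f \<le> embedding_const NX NY"
    unfolding embedding_const_def
  proof (rule Inf_greatest)
    fix d assume "d \<in> {c. \<forall>f \<in> fspace NX. NY f \<le> c * NX f}"
    with f have "NY f \<le> d * NX f" by blast
    then have "NY f / NX f \<le> d * NX f / NX f" by (rule divide_right_mono_ennreal)
    also have "\<dots> = d" using False fin by (simp add: mult_divide_eq_ennreal)
    finally show "NY f / NX f \<le> d" .
  qed
  then have "NY f / NX f * NX f \<le> embedding_const NX NY * NX f" by (rule mult_right_mono) simp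
  moreover have "NY f / NX f * NX f = NY f"
    using False fin by (simp add: ennreal_divide_times mult_divide_eq_ennreal)
  ultimately show ?thesis by simp
qed

end

theory Submission
  imports Defs
begin

text \<open>
  The two sides are equal. Raise everything to the power \<open>p\<close> and write \<open>N x\<close> for the
  \<open>q\<^sub>1\<close>-norm of \<open>u\<^sub>1\<close> over \<open>(0, x)\<close>, \<open>K t\<close> for the \<open>q\<^sub>2\<close>-norm of \<open>u\<^sub>2\<close> over \<open>(t, \<infinity>)\<close>.
  Since \<open>q\<^sub>2 / p > 1\<close>, Minkowski's integral inequality bounds the \<open>Ces\<close> norm of \<open>f\<close> by
  \<open>\<integral> (f v\<^sub>2 K)\<^sup>p\<close>; since \<open>q\<^sub>1 / p < 1\<close>, the reverse inequality bounds its \<open>Cop\<close> norm from below by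
  \<open>\<integral> (f v\<^sub>1 N)\<^sup>p\<close>. The upper estimate follows because \<open>v K \<le> B N\<close> almost everywhere.
  Conversely, testing an admissible constant \<open>c\<close> on \<open>f = 1\<^sub>E / v\<^sub>1\<close> with \<open>E \<subseteq> (0, min t r)\<close> gives
  \<open>v x K t \<le> c N r\<close> for almost every \<open>x < min t r\<close>, and then \<open>r\<close> tends to \<open>x\<close>.
\<close>

section \<open>Powers of extended non-negative numbers\<close>

lemma ennreal_mult_inverse: "x \<noteq> 0 \<Longrightarrow> x < top \<Longrightarrow> x * inverse x = (1 :: ennreal)"
  by (simp flip: divide_ennreal_def)

lemma epowr_ennreal: "0 \<le> x \<Longrightarrow> epowr (ennreal x) a = ennreal (x powr a)"
  by (simp add: epowr_def)

lemma epowr_top [simp]: "epowr top a = top"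
  by (simp add: epowr_def)

lemma epowr_zero [simp]: "epowr 0 a = 0"
  by (simp add: epowr_def)

lemma epowr_one [simp]: "epowr 1 a = 1"
  by (simp add: epowr_def)

lemma epowr_exponent_one [simp]: "epowr x 1 = x"
  by (cases x) (auto simp: epowr_ennreal)

lemma epowr_eq_0_iff [simp]: "epowr x a = 0 \<longleftrightarrow> x = 0"
  by (cases x) (auto simp: epowr_ennreal)

lemma epowr_eq_top_iff [simp]: "epowr x a = top \<longleftrightarrow> x = top"
  by (cases x) (auto simp: epowr_ennreal)

lemma epowr_less_top_iff [simp]: "epowr x a < top \<longleftrightarrow> x < top"
  using epowr_eq_top_iff[of x a] by (simp add: less_top[symmetric])

lemma epowr_pos_iff [simp]: "0 < epowr x a \<longleftrightarrow> 0 < x"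
  using epowr_eq_0_iff[of x a] by (simp add: zero_less_iff_neq_zero)

text \<open>The degenerate cases agree because \<open>epowr\<close> fixes 0 and \<infinity> for
  every real exponent, the former through the default \<open>0 powr a = 0\<close>, and because
  \<open>0 * \<infinity> = 0\<close> on both sides.\<close>

lemma epowr_mult: "epowr (x * y) a = epowr x a * epowr y a"
proof (cases "x = 0 \<or> y = 0 \<or> x = top \<or> y = top")
  case True
  then show ?thesis by (auto simp: ennreal_mult_top ennreal_top_mult)
next
  case False
  then show ?thesis
    by (cases x; cases y) (auto simp: epowr_ennreal powr_mult simp flip: ennreal_mult)
qed

lemma epowr_inverse: "epowr (inverse x) a = inverse (epowr x a)"
proof (cases "x = 0 \<or> x = top")
  case False
  then show ?thesis
    by (cases x) (auto simp: epowr_ennreal inverse_ennreal inverse_powr)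
qed auto

lemma epowr_epowr: "epowr (epowr x a) b = epowr x (a * b)"
  by (cases x) (auto simp: epowr_ennreal powr_powr)

lemma epowr_add: "epowr x (a + b) = epowr x a * epowr x b"
  by (cases x) (auto simp: epowr_ennreal powr_add simp flip: ennreal_mult)

lemma epowr_mono: "0 \<le> a \<Longrightarrow> x \<le> y \<Longrightarrow> epowr x a \<le> epowr y a"
  by (cases x; cases y) (auto simp: epowr_ennreal powr_mono2 top_unique)

lemma epowr_root: "a \<noteq> 0 \<Longrightarrow> epowr (epowr x a) (1 / a) = x"
  by (simp add: epowr_epowr)

lemma epowr_le_iff: "0 < a \<Longrightarrow> epowr x a \<le> epowr y a \<longleftrightarrow> x \<le> y"
  using epowr_mono[of a x y] epowr_mono[of "1 / a" "epowr x a" "epowr y a"]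
  by (auto simp: epowr_root)

lemma borel_measurable_epowr [measurable (raw)]:
  assumes [measurable]: "f \<in> borel_measurable M"
  shows "(\<lambda>x. epowr (f x) a) \<in> borel_measurable M"
  unfolding epowr_def by measurable

lemma epowr_indicator [simp]: "epowr (indicator A x) a = indicator A x"
  by (auto split: split_indicator)

section \<open>Young and Hoelder inequalities\<close>

text \<open>This is the weighted inequality between geometric and arithmetic means. Both weights are
  positive, so an infinite argument makes the right side infinite.\<close>

lemma epowr_Youngs_inequality:
  assumes th: "0 < \<theta>" "\<theta> < 1"
  shows "epowr x (1 - \<theta>) * epowr y \<theta> \<le> ennreal (1 - \<theta>) * x + ennreal \<theta> * y"
proof (cases "x = top \<or> y = top")
  case True
  with th show ?thesis by (auto simp: ennreal_mult_top)
next
  case False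
  then obtain a b where ab: "x = ennreal a" "0 \<le> a" "y = ennreal b" "0 \<le> b"
    by (cases x; cases y) auto
  have "a powr (1 - \<theta>) * b powr \<theta> \<le> (1 - \<theta>) * a + \<theta> * b"
    using Youngs_inequality_0[of "1 - \<theta>" \<theta> a b] ab th
    by (cases "a = 0 \<or> b = 0") auto
  with ab th show ?thesis
    by (simp add: epowr_ennreal flip: ennreal_mult ennreal_plus)
qed

text \<open>Dividing \<open>k\<close> and \<open>l\<close> by their integrals and applying Young's
  inequality pointwise gives a bound with total mass \<open>(1 - \<theta>) + \<theta> = 1\<close>.
  The case of a vanishing integral comes first: there the right side is 0 even if the other integral
  is infinite, and \<open>f\<close> vanishes almost everywhere. The hypothesis is an a.e. bound
  because the factorisation in the reverse Minkowski inequality is available only almost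
  everywhere.\<close>

lemma nn_integral_Hoelder:
  assumes th: "0 < \<theta>" "\<theta> < 1"
    and [measurable]: "f \<in> borel_measurable M" "k \<in> borel_measurable M" "l \<in> borel_measurable M"
    and le: "AE x in M. f x \<le> epowr (k x) (1 - \<theta>) * epowr (l x) \<theta>"
  shows "(\<integral>\<^sup>+x. f x \<partial>M) \<le> epowr (\<integral>\<^sup>+x. k x \<partial>M) (1 - \<theta>) * epowr (\<integral>\<^sup>+x. l x \<partial>M) \<theta>"
    (is "?F \<le> epowr ?K _ * epowr ?L _")
proof (cases "?K = 0 \<or> ?L = 0")
  case True
  then have "(AE x in M. k x = 0) \<or> (AE x in M. l x = 0)"
    by (simp add: nn_integral_0_iff_AE)
  with le have "AE x in M. f x = 0"
    by (auto elim!: AE_mp)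
  then show ?thesis
    by (simp add: nn_integral_0_iff_AE[THEN iffD2])
next
  case nz: False
  show ?thesis
  proof (cases "?K = top \<or> ?L = top")
    case True
    with nz show ?thesis by (auto simp: ennreal_mult_top ennreal_top_mult)
  next
    case False
    let ?c = "epowr ?K (1 - \<theta>) * epowr ?L \<theta>"
    have c: "?c \<noteq> 0" "?c \<noteq> top"
      using nz False by (auto simp: ennreal_mult_eq_top_iff)
    have "inverse ?c * ?F = (\<integral>\<^sup>+x. inverse ?c * f x \<partial>M)"
      by (simp add: nn_integral_cmult)
    also have "\<dots> \<le> (\<integral>\<^sup>+x. ennreal (1 - \<theta>) * (inverse ?K * k x) + ennreal \<theta> * (inverse ?L * l x) \<partial>M)"
    proof (rule nn_integral_mono_AE, use le in eventually_elim)
      fix x assume "f x \<le> epowr (k x) (1 - \<theta>) * epowr (l x) \<theta>"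
      then have "inverse ?c * f x \<le> inverse ?c * (epowr (k x) (1 - \<theta>) * epowr (l x) \<theta>)"
        by (intro mult_left_mono) auto
      also have "\<dots> = epowr (inverse ?K * k x) (1 - \<theta>) * epowr (inverse ?L * l x) \<theta>"
        using nz False by (simp add: epowr_mult epowr_inverse ennreal_inverse_mult less_top mult_ac)
      also have "\<dots> \<le> ennreal (1 - \<theta>) * (inverse ?K * k x) + ennreal \<theta> * (inverse ?L * l x)"
        by (rule epowr_Youngs_inequality[OF th])
      finally show "inverse ?c * f x \<le> \<dots>" .
    qed
    also have "\<dots> = ennreal (1 - \<theta>) * (inverse ?K * ?K) + ennreal \<theta> * (inverse ?L * ?L)"
      by (simp add: nn_integral_add nn_integral_cmult)
    also have "inverse ?K * ?K = 1"
      using nz False by (simp add: mult.commute[of "inverse _"] ennreal_mult_inverse less_top)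
    also have "inverse ?L * ?L = 1"
      using nz False by (simp add: mult.commute[of "inverse _"] ennreal_mult_inverse less_top)
    also have "ennreal (1 - \<theta>) * 1 + ennreal \<theta> * 1 = 1"
      using th by (simp flip: ennreal_plus)
    finally have "?c * (inverse ?c * ?F) \<le> ?c * 1"
      by (intro mult_left_mono) auto
    then show ?thesis
      using c by (simp add: mult.assoc[symmetric] ennreal_mult_inverse less_top)
  qed
qed

section \<open>Minkowski inequalities for indicator kernels\<close>

context pair_sigma_finite
begin

text \<open>The argument is a Schur test. Hoelder with an auxiliary power of \<open>V\<close> bounds
  each \<open>G t\<close> by a power of \<open>?R\<close> times a power of an integral that is
  linear in the kernel. After raising to the power \<open>1 / \<theta>\<close>, integration in
  \<open>t\<close> and Fubini reproduce \<open>?R\<close>.\<close>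

lemma Minkowski_indicator_kernel:
  assumes th: "0 < \<theta>" "\<theta> < 1"
    and [measurable]: "Q \<in> sets (M1 \<Otimes>\<^sub>M M2)" "h \<in> borel_measurable M1" "\<nu> \<in> borel_measurable M2"
    and V: "\<And>x. x \<in> space M1 \<Longrightarrow> V x = (\<integral>\<^sup>+t. indicator Q (x, t) * \<nu> t \<partial>M2)"
    and V_pos: "\<And>x. x \<in> space M1 \<Longrightarrow> 0 < V x" and V_fin: "\<And>x. x \<in> space M1 \<Longrightarrow> V x < top"
    and G: "\<And>t. t \<in> space M2 \<Longrightarrow> G t = (\<integral>\<^sup>+x. indicator Q (x, t) * h x \<partial>M1)"
  shows "epowr (\<integral>\<^sup>+t. epowr (G t) (1 / \<theta>) * \<nu> t \<partial>M2) \<theta> \<le> (\<integral>\<^sup>+x. h x * epowr (V x) \<theta> \<partial>M1)"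
proof -
  let ?R = "\<integral>\<^sup>+x. h x * epowr (V x) \<theta> \<partial>M1"
  have [measurable]: "V \<in> borel_measurable M1" "G \<in> borel_measurable M2"
    using V G by (simp_all cong: measurable_cong)
  \<comment> \<open>The exponent \<open>1 - \<theta>\<close> serves twice: the powers of
    \<open>V\<close> cancel in \<open>(h V\<^sup>\<theta>)\<^sup>1\<^sup>-\<^sup>\<theta>
    l\<^sup>\<theta> = h\<close>, and after Fubini \<open>l x * V x\<close> is the integrand of
    \<open>?R\<close> again.\<close>
  define l where "l x = h x * inverse (epowr (V x) (1 - \<theta>))" for x
  have [measurable]: "l \<in> borel_measurable M1" unfolding l_def by measurable
  have Hoelder: "epowr (G t) (1 / \<theta>) \<le> epowr ?R (1 / \<theta> - 1) * (\<integral>\<^sup>+x. indicator Q (x, t) * l x \<partial>M1)"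
    if t[measurable]: "t \<in> space M2" for t
  proof -
    have "G t \<le> epowr ?R (1 - \<theta>) * epowr (\<integral>\<^sup>+x. indicator Q (x, t) * l x \<partial>M1) \<theta>"
      unfolding G[OF t]
    proof (rule nn_integral_Hoelder[OF th])
      show "AE x in M1. indicator Q (x, t) * h x
          \<le> epowr (h x * epowr (V x) \<theta>) (1 - \<theta>) * epowr (indicator Q (x, t) * l x) \<theta>"
      proof (rule AE_I2)
        fix x assume x: "x \<in> space M1"
        have "epowr (h x * epowr (V x) \<theta>) (1 - \<theta>) * epowr (l x) \<theta>
          = (epowr (h x) (1 - \<theta>) * epowr (h x) \<theta>)
            * (epowr (V x) (\<theta> * (1 - \<theta>)) * inverse (epowr (V x) (\<theta> * (1 - \<theta>))))"
          by (simp add: l_def epowr_mult epowr_epowr epowr_inverse mult_ac)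
        also have "\<dots> = h x"
          using V_pos[OF x] V_fin[OF x]
          by (simp flip: epowr_add divide_ennreal_def add: ennreal_divide_self)
        finally show "indicator Q (x, t) * h x
          \<le> epowr (h x * epowr (V x) \<theta>) (1 - \<theta>) * epowr (indicator Q (x, t) * l x) \<theta>"
          by (auto split: split_indicator)
      qed
    qed measurable
    then have "epowr (G t) (1 / \<theta>)
        \<le> epowr (epowr ?R (1 - \<theta>) * epowr (\<integral>\<^sup>+x. indicator Q (x, t) * l x \<partial>M1) \<theta>) (1 / \<theta>)"
      using th by (intro epowr_mono) auto
    also have "\<dots> = epowr ?R (1 / \<theta> - 1) * (\<integral>\<^sup>+x. indicator Q (x, t) * l x \<partial>M1)"
      using th by (simp add: epowr_mult epowr_epowr diff_divide_distrib)
    finally show ?thesis .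
  qed
  have "(\<integral>\<^sup>+t. epowr (G t) (1 / \<theta>) * \<nu> t \<partial>M2)
      \<le> (\<integral>\<^sup>+t. epowr ?R (1 / \<theta> - 1) * (\<integral>\<^sup>+x. indicator Q (x, t) * l x \<partial>M1) * \<nu> t \<partial>M2)"
    by (intro nn_integral_mono mult_right_mono Hoelder) auto
  also have "\<dots> = epowr ?R (1 / \<theta> - 1) * (\<integral>\<^sup>+t. (\<integral>\<^sup>+x. indicator Q (x, t) * l x \<partial>M1) * \<nu> t \<partial>M2)"
    by (simp add: nn_integral_cmult mult.assoc)
  also have "(\<integral>\<^sup>+t. (\<integral>\<^sup>+x. indicator Q (x, t) * l x \<partial>M1) * \<nu> t \<partial>M2)
      = (\<integral>\<^sup>+t. \<integral>\<^sup>+x. indicator Q (x, t) * l x * \<nu> t \<partial>M1 \<partial>M2)"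
    by (intro nn_integral_cong) (simp add: nn_integral_multc)
  also have "(\<integral>\<^sup>+t. \<integral>\<^sup>+x. indicator Q (x, t) * l x * \<nu> t \<partial>M1 \<partial>M2)
      = (\<integral>\<^sup>+x. \<integral>\<^sup>+t. l x * (indicator Q (x, t) * \<nu> t) \<partial>M2 \<partial>M1)"
    by (subst Fubini') (auto simp: mult_ac)
  also have "\<dots> = (\<integral>\<^sup>+x. l x * V x \<partial>M1)"
    by (intro nn_integral_cong) (simp add: nn_integral_cmult V)
  also have "\<dots> = ?R"
  proof (intro nn_integral_cong)
    fix x assume x: "x \<in> space M1"
    have "V x = epowr (V x) (1 - \<theta>) * epowr (V x) \<theta>"
      by (simp flip: epowr_add)
    then have "l x * V x = h x * epowr (V x) \<theta> * (epowr (V x) (1 - \<theta>) * inverse (epowr (V x) (1 - \<theta>)))"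
      unfolding l_def by (metis mult.assoc mult.commute)
    also have "epowr (V x) (1 - \<theta>) * inverse (epowr (V x) (1 - \<theta>)) = 1"
      using V_pos[OF x] V_fin[OF x] by (simp flip: divide_ennreal_def add: ennreal_divide_self)
    finally show "l x * V x = h x * epowr (V x) \<theta>" by simp
  qed
  also have "epowr ?R (1 / \<theta> - 1) * ?R = epowr ?R (1 / \<theta>)"
    using epowr_add[of ?R "1 / \<theta> - 1" 1] by simp
  finally have "epowr (\<integral>\<^sup>+t. epowr (G t) (1 / \<theta>) * \<nu> t \<partial>M2) \<theta> \<le> epowr (epowr ?R (1 / \<theta>)) \<theta>"
    using th by (intro epowr_mono) auto
  then show ?thesis using th by (simp add: epowr_epowr)
qed

text \<open>The same scheme with the roles of the variables exchanged: now \<mu> is factored, with a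
  negative power of \<open>G\<close> as auxiliary weight. Hoelder bounds \<open>U x\<close>, and
  Fubini against \<open>g\<close> turns the linear integral into one of
  \<open>G * H * \<mu>\<close>, which is at most \<open>?\<Phi>\<close>.\<close>

lemma reverse_Minkowski_indicator_kernel:
  assumes th: "0 < \<theta>" "\<theta> < 1"
    and [measurable]: "Q \<in> sets (M1 \<Otimes>\<^sub>M M2)" "g \<in> borel_measurable M1" "\<mu> \<in> borel_measurable M2"
    and U: "\<And>x. x \<in> space M1 \<Longrightarrow> U x = (\<integral>\<^sup>+t. indicator Q (x, t) * \<mu> t \<partial>M2)"
    and G: "\<And>t. t \<in> space M2 \<Longrightarrow> G t = (\<integral>\<^sup>+x. indicator Q (x, t) * g x \<partial>M1)"
  shows "(\<integral>\<^sup>+x. g x * epowr (U x) (1 / \<theta>) \<partial>M1) \<le> epowr (\<integral>\<^sup>+t. epowr (G t) \<theta> * \<mu> t \<partial>M2) (1 / \<theta>)"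
proof -
  let ?\<Phi> = "\<integral>\<^sup>+t. epowr (G t) \<theta> * \<mu> t \<partial>M2"
  have [measurable]: "U \<in> borel_measurable M1" "G \<in> borel_measurable M2"
    using U G by (simp_all cong: measurable_cong)
  have swap: "(\<integral>\<^sup>+x. g x * (\<integral>\<^sup>+t. indicator Q (x, t) * w t \<partial>M2) \<partial>M1) = (\<integral>\<^sup>+t. G t * w t \<partial>M2)"
    if [measurable]: "w \<in> borel_measurable M2" for w
  proof -
    have "(\<integral>\<^sup>+x. g x * (\<integral>\<^sup>+t. indicator Q (x, t) * w t \<partial>M2) \<partial>M1)
        = (\<integral>\<^sup>+x. \<integral>\<^sup>+t. indicator Q (x, t) * g x * w t \<partial>M2 \<partial>M1)"
      by (intro nn_integral_cong) (simp add: nn_integral_cmult[symmetric] mult_ac)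
    also have "\<dots> = (\<integral>\<^sup>+t. \<integral>\<^sup>+x. indicator Q (x, t) * g x * w t \<partial>M1 \<partial>M2)"
      by (subst Fubini') auto
    also have "\<dots> = (\<integral>\<^sup>+t. G t * w t \<partial>M2)"
      by (intro nn_integral_cong) (simp add: nn_integral_multc G)
    finally show ?thesis .
  qed
  consider "?\<Phi> = top" | "?\<Phi> = 0" | "?\<Phi> \<noteq> 0" "?\<Phi> < top"
    by (cases ?\<Phi>) auto
  then show ?thesis
  proof cases
    case 1
    then show ?thesis by simp
  next
    case 2
    \<comment> \<open>This case needs its own argument: the Hoelder bound below would have the
      factor 0, which annihilates even an infinite integral. Instead \<open>g * U\<close> has
      integral 0 by Fubini, and \<open>U\<close> vanishes exactly where its powers do.\<close>
    then have "AE t in M2. G t * \<mu> t = 0" by (simp add: nn_integral_0_iff_AE)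
    then have "(\<integral>\<^sup>+x. g x * U x \<partial>M1) = 0"
      using swap[of \<mu>] by (simp add: nn_integral_0_iff_AE U cong: nn_integral_cong)
    then have "AE x in M1. g x * epowr (U x) (1 / \<theta>) = 0"
      by (simp add: nn_integral_0_iff_AE)
    then show ?thesis by (simp add: nn_integral_0_iff_AE[THEN iffD2])
  next
    case 3
    \<comment> \<open>In \<open>ennreal\<close>, \<open>H\<close> is \<open>\<infinity>\<close> where \<open>G = 0\<close>; there the bound \<open>G H \<le> G\<^sup>\<theta>\<close> survives since \<open>0 * \<infinity> = 0\<close>.\<close>
    define H where "H t = inverse (epowr (G t) (1 - \<theta>))" for t
    have [measurable]: "H \<in> borel_measurable M2" unfolding H_def by measurable
    have GH: "G t * H t \<le> epowr (G t) \<theta>" for t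
    proof (cases "G t = 0 \<or> G t = top")
      case False
      have "G t = epowr (G t) \<theta> * epowr (G t) (1 - \<theta>)"
        by (simp flip: epowr_add)
      then have "G t * H t = epowr (G t) \<theta> * (epowr (G t) (1 - \<theta>) * inverse (epowr (G t) (1 - \<theta>)))"
        unfolding H_def by (metis mult.assoc)
      then show ?thesis using False
        by (simp flip: divide_ennreal_def add: ennreal_divide_self less_top)
    qed (auto simp: H_def)
    have AE_fin: "AE t in M2. epowr (G t) \<theta> * \<mu> t \<noteq> \<infinity>"
      using 3 by (intro nn_integral_noteq_infinite) auto
    have Hoelder: "U x \<le> epowr ?\<Phi> (1 - \<theta>) * epowr (\<integral>\<^sup>+t. indicator Q (x, t) * (H t * \<mu> t) \<partial>M2) \<theta>"
      (is "_ \<le> _ * epowr ?I \<theta>") if x[measurable]: "x \<in> space M1" for x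
    proof (cases "?I = top")
      case True
      with 3 show ?thesis by (simp add: ennreal_mult_top)
    next
      case False
      then have "AE t in M2. indicator Q (x, t) * (H t * \<mu> t) \<noteq> \<infinity>"
        by (intro nn_integral_noteq_infinite) auto
      with AE_fin have "AE t in M2. indicator Q (x, t) * \<mu> t
          \<le> epowr (epowr (G t) \<theta> * \<mu> t) (1 - \<theta>) * epowr (indicator Q (x, t) * (H t * \<mu> t)) \<theta>"
      proof eventually_elim
        case (elim t)
        show ?case
        proof (cases "indicator Q (x, t) * \<mu> t = 0")
          case False
          \<comment> \<open>Off the zero set of \<open>indicator Q (x, t) * \<mu> t\<close>, a value
            \<open>G t = 0\<close> would make \<open>H t * \<mu> t\<close> infinite, and an infinite
            \<open>G t\<close> would make \<open>epowr (G t) \<theta> * \<mu> t\<close> infinite.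
            Finiteness of \<open>?I\<close> and \<open>?\<Phi>\<close> excludes both almost
            everywhere.\<close>
          with elim have Gt: "0 < G t" "G t < top"
            by (auto simp: H_def ennreal_mult_top ennreal_top_mult zero_less_iff_neq_zero less_top[symmetric]
                split: split_indicator_asm)
          have "epowr (epowr (G t) \<theta> * \<mu> t) (1 - \<theta>) * epowr (H t * \<mu> t) \<theta>
            = (epowr (\<mu> t) (1 - \<theta>) * epowr (\<mu> t) \<theta>)
              * (epowr (G t) (\<theta> * (1 - \<theta>)) * inverse (epowr (G t) (\<theta> * (1 - \<theta>))))"
            by (simp add: H_def epowr_mult epowr_epowr epowr_inverse mult_ac)
          also have "\<dots> = \<mu> t"
            using Gt by (simp flip: epowr_add divide_ennreal_def add: ennreal_divide_self)
          finally show ?thesis by (auto split: split_indicator)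
        next
          case True
          show ?thesis unfolding True by simp
        qed
      qed
      then show ?thesis
        unfolding U[OF x] by (intro nn_integral_Hoelder[OF th]) measurable
    qed
    have "(\<integral>\<^sup>+x. g x * epowr (U x) (1 / \<theta>) \<partial>M1)
        \<le> (\<integral>\<^sup>+x. g x * (epowr ?\<Phi> (1 / \<theta> - 1) * (\<integral>\<^sup>+t. indicator Q (x, t) * (H t * \<mu> t) \<partial>M2)) \<partial>M1)"
    proof (intro nn_integral_mono mult_left_mono)
      fix x assume "x \<in> space M1"
      from Hoelder[OF this] have "epowr (U x) (1 / \<theta>) \<le> epowr (epowr ?\<Phi> (1 - \<theta>)
          * epowr (\<integral>\<^sup>+t. indicator Q (x, t) * (H t * \<mu> t) \<partial>M2) \<theta>) (1 / \<theta>)"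
        using th by (intro epowr_mono) auto
      then show "epowr (U x) (1 / \<theta>)
          \<le> epowr ?\<Phi> (1 / \<theta> - 1) * (\<integral>\<^sup>+t. indicator Q (x, t) * (H t * \<mu> t) \<partial>M2)"
        using th by (simp add: epowr_mult epowr_epowr diff_divide_distrib)
    qed simp
    also have "\<dots> = epowr ?\<Phi> (1 / \<theta> - 1) * (\<integral>\<^sup>+t. G t * (H t * \<mu> t) \<partial>M2)"
      by (subst swap[symmetric]) (auto simp: nn_integral_cmult[symmetric] mult_ac)
    also have "\<dots> \<le> epowr ?\<Phi> (1 / \<theta> - 1) * ?\<Phi>"
      by (intro mult_left_mono nn_integral_mono) (auto simp: mult.assoc[symmetric] intro!: mult_right_mono GH)
    also have "\<dots> = epowr ?\<Phi> (1 / \<theta>)"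
      using epowr_add[of ?\<Phi> "1 / \<theta> - 1" 1] by simp
    finally show ?thesis .
  qed
qed

end

section \<open>Lebesgue measure and norms on the half-line\<close>

abbreviation halfline :: "real measure" where
  "halfline \<equiv> lebesgue_on {0<..}"

text \<open>Fubini's theorem rests on this. A countable cover by sets of finite
  \<open>lborel\<close> measure serves for the completion as well, and restriction preserves the
  property.\<close>

lemma sigma_finite_halfline: "sigma_finite_measure halfline"
proof (rule sigma_finite_measure_restrict_space)
  obtain \<A> :: "real set set" where "countable \<A>" "\<A> \<subseteq> sets lborel" "\<Union>\<A> = space lborel"
    "\<forall>a\<in>\<A>. emeasure lborel a \<noteq> \<infinity>"
    using lborel.sigma_finite_countable by blast
  then show "sigma_finite_measure (lebesgue :: real measure)"
    by unfold_locales (auto intro!: exI[of _ \<A>] simp: subset_eq)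
qed simp

text \<open>Moves a varying domain into the integrand, so that norms over different intervals live
  on one measure space and an endpoint can become a variable of a product kernel.\<close>

lemma nn_integral_lebesgue_on_halfline:
  assumes "A \<in> sets lebesgue" "A \<subseteq> {0<..}"
  shows "(\<integral>\<^sup>+x. f x \<partial>lebesgue_on A) = (\<integral>\<^sup>+x. indicator A x * f x \<partial>halfline)"
  using assms by (auto simp: nn_integral_restrict_space intro!: nn_integral_cong split: split_indicator)

lemma AE_lebesgue_on_halfline:
  assumes "A \<in> sets lebesgue" "A \<subseteq> {0<..}"
  shows "(AE x in lebesgue_on A. P x) \<longleftrightarrow> (AE x in halfline. x \<in> A \<longrightarrow> P x)"
  using assms by (auto simp: AE_restrict_space_iff elim!: eventually_mono)

lemma AE_halfline_neq: "AE x in halfline. x \<noteq> a"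
  using AE_completion[OF AE_lborel_singleton[of a]]
  by (auto simp: AE_restrict_space_iff elim!: eventually_mono)

lemma borel_measurable_lebesgue_on_halfline:
  assumes "f \<in> borel_measurable halfline" "A \<subseteq> {0<..}"
  shows "f \<in> borel_measurable (lebesgue_on A)"
  by (rule measurable_restrict_mono[OF assms])

text \<open>Makes the coordinates of points of \<open>halfline \<Otimes>\<^sub>M halfline\<close>
  Borel functions, as the measurability of the triangles \<open>Q\<close> below requires.\<close>

lemma id_borel_measurable_lebesgue_on [measurable]: "(\<lambda>x. x) \<in> borel_measurable (lebesgue_on A)"
  by (rule measurable_restrict_space1) (auto intro: measurable_completion)

lemma lp_norm_eq: "0 < p \<Longrightarrow>
    lp_norm (ennreal p) A f = epowr (\<integral>\<^sup>+x. epowr (f x) p \<partial>lebesgue_on A) (1 / p)"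
  by (simp add: lp_norm_def)

lemma epowr_lp_norm: "0 < p \<Longrightarrow>
    epowr (lp_norm (ennreal p) A f) p = (\<integral>\<^sup>+x. epowr (f x) p \<partial>lebesgue_on A)"
  by (simp add: lp_norm_eq epowr_epowr)

lemma lp_norm_mono:
  assumes "0 < p" "\<And>x. x \<in> A \<Longrightarrow> f x \<le> g x"
  shows "lp_norm (ennreal p) A f \<le> lp_norm (ennreal p) A g"
  using assms by (auto simp: lp_norm_eq space_restrict_space intro!: epowr_mono nn_integral_mono)

lemma lp_norm_indicator:
  assumes "0 < p" "A \<in> sets lebesgue" "A \<subseteq> {0<..}"
  shows "lp_norm (ennreal p) A f = lp_norm (ennreal p) {0<..} (\<lambda>x. indicator A x * f x)"
  using assms by (simp add: lp_norm_eq nn_integral_lebesgue_on_halfline[of A] epowr_mult)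

lemma lp_norm_mono_set:
  assumes "0 < p" "A \<in> sets lebesgue" "B \<in> sets lebesgue" "A \<subseteq> B" "B \<subseteq> {0<..}"
  shows "lp_norm (ennreal p) A f \<le> lp_norm (ennreal p) B f"
proof -
  have "A \<subseteq> {0<..}" using assms by auto
  then show ?thesis
    unfolding lp_norm_indicator[OF assms(1,2) \<open>A \<subseteq> {0<..}\<close>, of f] lp_norm_indicator[OF assms(1,3,5), of f]
    using assms by (intro lp_norm_mono) (auto split: split_indicator)
qed

lemma lp_norm_cmult:
  assumes "0 < p" "f \<in> borel_measurable (lebesgue_on A)"
  shows "lp_norm (ennreal p) A (\<lambda>x. c * f x) = c * lp_norm (ennreal p) A f"
proof -
  have [measurable]: "(\<lambda>x. epowr (f x) p) \<in> borel_measurable (lebesgue_on A)"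
    using assms by measurable
  show ?thesis using assms(1)
    by (simp add: lp_norm_eq epowr_mult nn_integral_cmult epowr_epowr)
qed

lemma lp_norm_const_indicator:
  assumes "0 < p" "E \<in> sets halfline"
  shows "lp_norm (ennreal p) {0<..} (indicator E) = epowr (emeasure halfline E) (1 / p)"
  using assms by (simp add: lp_norm_eq)

section \<open>One-sided limits of norms in the endpoint of the interval\<close>

text \<open>As \<open>r\<close> decreases to \<open>x\<close>, the integral of the
  \<open>q\<close>-th power over \<open>(0, r)\<close> tends to that over \<open>(0, x)\<close> by
  dominated convergence, with the finite integral over \<open>(0, x + 1)\<close> as majorant.
  Finiteness of \<open>c\<close> lets the product pass to the limit.\<close>

lemma le_cmult_lp_norm_initial_limit:
  fixes a c :: ennreal
  assumes q: "0 < q" and u: "u \<in> borel_measurable halfline"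
    and fin: "\<And>r. 0 < r \<Longrightarrow> lp_norm (ennreal q) {0<..<r} u < top"
    and c: "c < top"
    and le: "\<And>r. x < r \<Longrightarrow> a \<le> c * lp_norm (ennreal q) {0<..<r} u" and x: "0 < x"
  shows "a \<le> c * lp_norm (ennreal q) {0<..<x} u"
proof -
  define U where "U r = (\<integral>\<^sup>+s. indicator {0<..<r} s * epowr (u s) q \<partial>halfline)" for r
  have U: "epowr (lp_norm (ennreal q) {0<..<r} u) q = U r" for r
    using q unfolding U_def by (subst epowr_lp_norm) (auto intro: nn_integral_lebesgue_on_halfline)
  define r where "r n = x + inverse (real (Suc n))" for n
  have r: "x < r n" "r n \<le> x + 1" for n
    by (auto simp: r_def field_simps)
  have r_lim: "r \<longlonglongrightarrow> x"
    using tendsto_add[OF tendsto_const LIMSEQ_inverse_real_of_nat, of x] by (simp add: r_def[abs_def])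
  note [measurable] = u
  have "(\<lambda>n. U (r n)) \<longlonglongrightarrow> U x"
    unfolding U_def
  proof (rule nn_integral_dominated_convergence[where w = "\<lambda>s. indicator {0<..<x + 1} s * epowr (u s) q"])
    show "AE s in halfline. indicator {0<..<r n} s * epowr (u s) q
        \<le> indicator {0<..<x + 1} s * epowr (u s) q" for n
      using r(2)[of n] by (auto split: split_indicator)
    show "(\<integral>\<^sup>+s. indicator {0<..<x + 1} s * epowr (u s) q \<partial>halfline) < \<infinity>"
      using fin[of "x + 1"] x by (simp add: U_def[symmetric] U[symmetric])
    \<comment> \<open>The open intervals \<open>(0, r n)\<close> shrink to \<open>(0, x]\<close>, so
      the indicators converge to that of \<open>(0, x)\<close> except at the null point
      \<open>s = x\<close>.\<close>
    show "AE s in halfline. (\<lambda>n. indicator {0<..<r n} s * epowr (u s) q)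
        \<longlonglongrightarrow> indicator {0<..<x} s * epowr (u s) q"
      using AE_halfline_neq[of x]
    proof eventually_elim
      case (elim s)
      show ?case
      proof (cases "s < x")
        case True
        then have "indicator {0<..<r n} s = (indicator {0<..<x} s :: ennreal)" for n
          using r(1)[of n] by (auto split: split_indicator)
        then show ?thesis by simp
      next
        case False
        with elim have "\<forall>\<^sub>F n in sequentially. r n < s"
          by (intro order_tendstoD(2)[OF r_lim]) auto
        then have "\<forall>\<^sub>F n in sequentially. indicator {0<..<r n} s * epowr (u s) q
            = indicator {0<..<x} s * epowr (u s) q"
          by eventually_elim (use False in \<open>auto split: split_indicator\<close>)
        then show ?thesis by (rule tendsto_eventually)
      qed
    qed
  qed measurable
  then have lim: "(\<lambda>n. epowr c q * U (r n)) \<longlonglongrightarrow> epowr c q * U x"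
    using c by (intro ennreal_tendsto_cmult) auto
  have "epowr a q \<le> epowr c q * U (r n)" for n
    using epowr_mono[OF _ le[OF r(1)[of n]], of q] q by (simp add: epowr_mult U)
  then have "epowr a q \<le> epowr c q * U x"
    by (intro LIMSEQ_le_const[OF lim]) auto
  then have "epowr a q \<le> epowr (c * lp_norm (ennreal q) {0<..<x} u) q"
    by (simp add: epowr_mult U)
  then show ?thesis using q by (simp add: epowr_le_iff)
qed

text \<open>Here the intervals \<open>(r, \<infinity>)\<close> grow to
  \<open>(x, \<infinity>)\<close> as \<open>r\<close> decreases to \<open>x\<close>, so monotone
  convergence applies, and suprema commute with multiplication by any \<open>a\<close>, infinite or
  not.\<close>

lemma cmult_lp_norm_final_le_limit:
  assumes q: "0 < q" and u: "u \<in> borel_measurable halfline"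
    and le: "\<And>r. x < r \<Longrightarrow> a * lp_norm (ennreal q) {r<..} u \<le> b" and x: "0 < x"
  shows "a * lp_norm (ennreal q) {x<..} u \<le> b"
proof -
  define V where "V r = (\<integral>\<^sup>+s. indicator {r<..} s * epowr (u s) q \<partial>halfline)" for r
  have V: "epowr (lp_norm (ennreal q) {r<..} u) q = V r" if "0 < r" for r
    using q that unfolding V_def by (subst epowr_lp_norm) (auto intro: nn_integral_lebesgue_on_halfline)
  define r where "r n = x + inverse (real (Suc n))" for n
  have r: "x < r n" "0 < r n" for n
    using x by (auto simp: r_def add_pos_pos)
  have r_lim: "r \<longlonglongrightarrow> x"
    using tendsto_add[OF tendsto_const LIMSEQ_inverse_real_of_nat, of x] by (simp add: r_def[abs_def])
  have r_mono: "r n \<le> r m" if "m \<le> n" for m n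
    using that by (simp add: r_def le_imp_inverse_le)
  note [measurable] = u
  have "V x = (\<integral>\<^sup>+s. (SUP n. indicator {r n<..} s * epowr (u s) q) \<partial>halfline)"
    unfolding V_def
  proof (intro nn_integral_cong)
    fix s
    show "indicator {x<..} s * epowr (u s) q = (SUP n. indicator {r n<..} s * epowr (u s) q)"
    proof (cases "x < s")
      case True
      then obtain n where "r n < s"
        using order_tendstoD(2)[OF r_lim True] by (auto simp: eventually_sequentially)
      then show ?thesis using True
        by (intro antisym SUP_upper2[of n] SUP_least) (auto split: split_indicator)
    next
      case False
      then have "indicator {r n<..} s = (0 :: ennreal)" for n
        using r(1)[of n] by (auto split: split_indicator)
      with False show ?thesis by simp
    qed
  qed
  also have "\<dots> = (SUP n. V (r n))"
    unfolding V_def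
  proof (rule nn_integral_monotone_convergence_SUP)
    show "incseq (\<lambda>n s. indicator {r n<..} s * epowr (u s) q)"
    proof (intro monoI le_funI)
      fix m n :: nat and s assume "m \<le> n"
      from r_mono[OF this] show "indicator {r m<..} s * epowr (u s) q \<le> indicator {r n<..} s * epowr (u s) q"
        by (auto split: split_indicator)
    qed
  qed measurable
  finally have "epowr a q * V x = (SUP n. epowr a q * V (r n))"
    by (simp add: SUP_mult_left_ennreal)
  also have "\<dots> \<le> epowr b q"
  proof (rule SUP_least)
    fix n
    show "epowr a q * V (r n) \<le> epowr b q"
      using epowr_mono[OF _ le[OF r(1)[of n]], of q] q r(2)[of n] by (simp add: epowr_mult V)
  qed
  finally have "epowr (a * lp_norm (ennreal q) {x<..} u) q \<le> epowr b q"
    using x by (simp add: epowr_mult V)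
  then show ?thesis using q by (simp add: epowr_le_iff)
qed

section \<open>Weighted integral bounds for the Cesaro and Copson norms\<close>

text \<open>Minkowski's inequality with \<open>\<theta> = p / q\<close> on the triangle
  \<open>x < t\<close>. Membership of \<open>u\<close> in \<open>omega\<close> keeps
  \<open>V\<close> positive and finite.\<close>

lemma ces_norm_le:
  assumes q: "0 < p" "p < q" and f: "f \<in> mplus" "v \<in> mplus" and u: "u \<in> omega (ennreal q)"
  shows "epowr (ces_norm (ennreal p) (ennreal q) u v f) p
    \<le> (\<integral>\<^sup>+x. epowr (f x * v x) p * epowr (lp_norm (ennreal q) {x<..} u) p \<partial>halfline)"
proof -
  interpret sigma_finite_measure halfline by (rule sigma_finite_halfline)
  interpret pair_sigma_finite halfline halfline ..
  have [measurable]: "f \<in> borel_measurable halfline" "v \<in> borel_measurable halfline" "u \<in> borel_measurable halfline"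
    using f u by (auto simp: mplus_def omega_def)
  define Q where "Q = {z \<in> space (halfline \<Otimes>\<^sub>M halfline). fst z < snd z}"
  have [measurable]: "Q \<in> sets (halfline \<Otimes>\<^sub>M halfline)" unfolding Q_def by measurable
  define h where "h x = epowr (f x * v x) p" for x
  have [measurable]: "h \<in> borel_measurable halfline" unfolding h_def by measurable
  define G where "G t = epowr (lp_norm (ennreal p) {0<..<t} (\<lambda>x. f x * v x)) p" for t
  define V where "V x = epowr (lp_norm (ennreal q) {x<..} u) q" for x
  have "epowr (\<integral>\<^sup>+t. epowr (G t) (1 / (p / q)) * epowr (u t) q \<partial>halfline) (p / q)
      \<le> (\<integral>\<^sup>+x. h x * epowr (V x) (p / q) \<partial>halfline)"
  proof (rule Minkowski_indicator_kernel[where Q = Q])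
    show "0 < p / q" "p / q < 1" using q by auto
    show "V x = (\<integral>\<^sup>+t. indicator Q (x, t) * epowr (u t) q \<partial>halfline)" if "x \<in> space halfline" for x
    proof -
      have "V x = (\<integral>\<^sup>+t. epowr (u t) q \<partial>lebesgue_on {x<..})"
        using q by (simp add: V_def epowr_lp_norm)
      also have "\<dots> = (\<integral>\<^sup>+t. indicator {x<..} t * epowr (u t) q \<partial>halfline)"
        using that by (intro nn_integral_lebesgue_on_halfline) auto
      also have "\<dots> = (\<integral>\<^sup>+t. indicator Q (x, t) * epowr (u t) q \<partial>halfline)"
        using that by (intro nn_integral_cong) (auto simp: Q_def space_pair_measure split: split_indicator)
      finally show ?thesis .
    qed
    show "0 < V x" "V x < top" if "x \<in> space halfline" for x
      using u that by (auto simp: V_def omega_def)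
    show "G t = (\<integral>\<^sup>+x. indicator Q (x, t) * h x \<partial>halfline)" if "t \<in> space halfline" for t
    proof -
      have "G t = (\<integral>\<^sup>+x. h x \<partial>lebesgue_on {0<..<t})"
        using q by (simp add: G_def h_def epowr_lp_norm)
      also have "\<dots> = (\<integral>\<^sup>+x. indicator {0<..<t} x * h x \<partial>halfline)"
        by (intro nn_integral_lebesgue_on_halfline) auto
      also have "\<dots> = (\<integral>\<^sup>+x. indicator Q (x, t) * h x \<partial>halfline)"
        using that by (intro nn_integral_cong) (auto simp: Q_def space_pair_measure split: split_indicator)
      finally show ?thesis .
    qed
  qed measurable
  moreover have "epowr (G t) (1 / (p / q)) * epowr (u t) q
      = epowr (lp_norm (ennreal p) {0<..<t} (\<lambda>x. f x * v x) * u t) q" for t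
    using q by (simp add: G_def epowr_epowr epowr_mult)
  moreover have "epowr (V x) (p / q) = epowr (lp_norm (ennreal q) {x<..} u) p" for x
    using q by (simp add: V_def epowr_epowr)
  ultimately show ?thesis
    using q by (simp add: ces_norm_def wlp_norm_def lp_norm_eq[of q "{0<..}"] epowr_epowr h_def)
qed

text \<open>The reverse inequality with \<open>\<theta> = q / p\<close> on the triangle
  \<open>t < x\<close>.\<close>

lemma cop_norm_ge:
  assumes q: "0 < q" "q < p" and f: "f \<in> mplus" "v \<in> mplus" "u \<in> mplus"
  shows "(\<integral>\<^sup>+x. epowr (f x * v x) p * epowr (lp_norm (ennreal q) {0<..<x} u) p \<partial>halfline)
    \<le> epowr (cop_norm (ennreal p) (ennreal q) u v f) p"
proof -
  interpret sigma_finite_measure halfline by (rule sigma_finite_halfline)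
  interpret pair_sigma_finite halfline halfline ..
  have [measurable]: "f \<in> borel_measurable halfline" "v \<in> borel_measurable halfline" "u \<in> borel_measurable halfline"
    using f by (auto simp: mplus_def)
  define Q where "Q = {z \<in> space (halfline \<Otimes>\<^sub>M halfline). snd z < fst z}"
  have [measurable]: "Q \<in> sets (halfline \<Otimes>\<^sub>M halfline)" unfolding Q_def by measurable
  define g where "g x = epowr (f x * v x) p" for x
  have [measurable]: "g \<in> borel_measurable halfline" unfolding g_def by measurable
  define G where "G t = epowr (lp_norm (ennreal p) {t<..} (\<lambda>x. f x * v x)) p" for t
  define U where "U x = epowr (lp_norm (ennreal q) {0<..<x} u) q" for x
  have "(\<integral>\<^sup>+x. g x * epowr (U x) (1 / (q / p)) \<partial>halfline)
      \<le> epowr (\<integral>\<^sup>+t. epowr (G t) (q / p) * epowr (u t) q \<partial>halfline) (1 / (q / p))"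
  proof (rule reverse_Minkowski_indicator_kernel[where Q = Q])
    show "0 < q / p" "q / p < 1" using q by auto
    show "U x = (\<integral>\<^sup>+t. indicator Q (x, t) * epowr (u t) q \<partial>halfline)" if "x \<in> space halfline" for x
    proof -
      have "U x = (\<integral>\<^sup>+t. epowr (u t) q \<partial>lebesgue_on {0<..<x})"
        using q by (simp add: U_def epowr_lp_norm)
      also have "\<dots> = (\<integral>\<^sup>+t. indicator {0<..<x} t * epowr (u t) q \<partial>halfline)"
        by (intro nn_integral_lebesgue_on_halfline) auto
      also have "\<dots> = (\<integral>\<^sup>+t. indicator Q (x, t) * epowr (u t) q \<partial>halfline)"
        using that by (intro nn_integral_cong) (auto simp: Q_def space_pair_measure split: split_indicator)
      finally show ?thesis .
    qed
    show "G t = (\<integral>\<^sup>+x. indicator Q (x, t) * g x \<partial>halfline)" if "t \<in> space halfline" for t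
    proof -
      have "G t = (\<integral>\<^sup>+x. g x \<partial>lebesgue_on {t<..})"
        using q by (simp add: G_def g_def epowr_lp_norm)
      also have "\<dots> = (\<integral>\<^sup>+x. indicator {t<..} x * g x \<partial>halfline)"
        using that by (intro nn_integral_lebesgue_on_halfline) auto
      also have "\<dots> = (\<integral>\<^sup>+x. indicator Q (x, t) * g x \<partial>halfline)"
        using that by (intro nn_integral_cong) (auto simp: Q_def space_pair_measure split: split_indicator)
      finally show ?thesis .
    qed
  qed measurable
  moreover have "epowr (G t) (q / p) * epowr (u t) q
      = epowr (lp_norm (ennreal p) {t<..} (\<lambda>x. f x * v x) * u t) q" for t
    using q by (simp add: G_def epowr_epowr epowr_mult)
  moreover have "epowr (U x) (1 / (q / p)) = epowr (lp_norm (ennreal q) {0<..<x} u) p" for x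
    using q by (simp add: U_def epowr_epowr)
  ultimately show ?thesis
    using q by (simp add: cop_norm_def wlp_norm_def lp_norm_eq[of q "{0<..}"] epowr_epowr g_def)
qed

section \<open>Norms of test functions\<close>

text \<open>The weighted test function is at most \<open>indicator E\<close>. Its norm over
  \<open>(s, \<infinity>)\<close> is therefore at most
  \<open>epowr (emeasure halfline E) (1 / p)\<close>, and it is 0 once \<open>s \<ge> r\<close>,
  since \<open>E\<close> lies below \<open>r\<close>.\<close>

lemma cop_norm_test_function_le:
  assumes q: "0 < q" "0 < p" and E: "E \<in> sets halfline" "E \<subseteq> {0<..<r}"
    and v: "v \<in> mplus" and u: "u \<in> mplus"
  shows "cop_norm (ennreal p) (ennreal q) u v (\<lambda>x. indicator E x * inverse (v x))
    \<le> epowr (emeasure halfline E) (1 / p) * lp_norm (ennreal q) {0<..<r} u"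
proof -
  let ?f = "\<lambda>x. indicator E x * inverse (v x) * v x"
  \<comment> \<open>Only an inequality holds, as the product is 0 for \<open>a\<close> equal to 0 or
    \<infinity>.\<close>
  have inv: "inverse a * a \<le> (1 :: ennreal)" for a
    by (cases "a = 0 \<or> a = top") (auto simp: mult.commute[of "inverse a"] ennreal_mult_inverse less_top)
  have inner: "lp_norm (ennreal p) {s<..} ?f * u s
      \<le> epowr (emeasure halfline E) (1 / p) * (indicator {0<..<r} s * u s)" if s: "0 < s" for s
  proof (cases "s < r")
    case True
    have "lp_norm (ennreal p) {s<..} ?f \<le> lp_norm (ennreal p) {0<..} ?f"
      using q s by (intro lp_norm_mono_set) auto
    also have "\<dots> \<le> lp_norm (ennreal p) {0<..} (indicator E)"
      using q inv by (intro lp_norm_mono) (auto split: split_indicator)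
    also have "\<dots> = epowr (emeasure halfline E) (1 / p)"
      using q E by (intro lp_norm_const_indicator) auto
    finally show ?thesis using True s by (auto intro: mult_right_mono)
  next
    case False
    have "lp_norm (ennreal p) {s<..} ?f \<le> lp_norm (ennreal p) {s<..} (\<lambda>x. 0)"
      using q False E(2) by (intro lp_norm_mono) (auto split: split_indicator)
    also have "\<dots> = 0" using q by (simp add: lp_norm_eq)
    finally show ?thesis by simp
  qed
  have "(\<lambda>s. indicator {0<..<r} s * u s) \<in> borel_measurable halfline"
    using u unfolding mplus_def by measurable
  then have "lp_norm (ennreal q) {0<..} (\<lambda>s. epowr (emeasure halfline E) (1 / p) * (indicator {0<..<r} s * u s))
      = epowr (emeasure halfline E) (1 / p) * lp_norm (ennreal q) {0<..} (\<lambda>s. indicator {0<..<r} s * u s)"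
    using q by (intro lp_norm_cmult) auto
  also have "lp_norm (ennreal q) {0<..} (\<lambda>s. indicator {0<..<r} s * u s) = lp_norm (ennreal q) {0<..<r} u"
    using q by (intro lp_norm_indicator[symmetric]) auto
  finally show ?thesis
    unfolding cop_norm_def wlp_norm_def using q inner
    by (metis (no_types, lifting) greaterThan_iff lp_norm_mono)
qed

text \<open>For \<open>s > t\<close> the interval \<open>(0, s)\<close> contains all of
  \<open>E\<close>, so the inner norm has the constant value \<open>?W\<close>; the outer norm is
  then restricted to \<open>(t, \<infinity>)\<close>.\<close>

lemma ces_norm_test_function_ge:
  assumes q: "0 < q" "0 < p" and E: "E \<subseteq> {0<..<t}" and t: "0 < t" and u: "u \<in> mplus"
    and w: "w = (\<lambda>x. inverse (v' x) * v x)"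
  shows "lp_norm (ennreal p) {0<..} (\<lambda>x. indicator E x * w x) * lp_norm (ennreal q) {t<..} u
    \<le> ces_norm (ennreal p) (ennreal q) u v (\<lambda>x. indicator E x * inverse (v' x))"proof -
  let ?W = "lp_norm (ennreal p) {0<..} (\<lambda>x. indicator E x * w x)"
  have meas: "(\<lambda>s. indicator {t<..} s * u s) \<in> borel_measurable halfline"
    using u unfolding mplus_def by measurable
  have "?W * lp_norm (ennreal q) {t<..} u = ?W * lp_norm (ennreal q) {0<..} (\<lambda>s. indicator {t<..} s * u s)"
    using q t by (subst lp_norm_indicator[of q "{t<..}"]) auto
  also have "\<dots> = lp_norm (ennreal q) {0<..} (\<lambda>s. ?W * (indicator {t<..} s * u s))"
    using q meas by (intro lp_norm_cmult[symmetric]) auto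
  also have "\<dots> \<le> lp_norm (ennreal q) {0<..}
      (\<lambda>s. lp_norm (ennreal p) {0<..<s} (\<lambda>x. indicator E x * inverse (v' x) * v x) * u s)"
  proof (rule lp_norm_mono[OF q(1)])
    fix s :: real
    show "?W * (indicator {t<..} s * u s)
      \<le> lp_norm (ennreal p) {0<..<s} (\<lambda>x. indicator E x * inverse (v' x) * v x) * u s"
    proof (cases "t < s")
      case True
      have "lp_norm (ennreal p) {0<..<s} (\<lambda>x. indicator E x * inverse (v' x) * v x)
          = lp_norm (ennreal p) {0<..} (\<lambda>x. indicator {0<..<s} x * (indicator E x * inverse (v' x) * v x))"
        using q by (intro lp_norm_indicator) auto
      also have "(\<lambda>x. indicator {0<..<s} x * (indicator E x * inverse (v' x) * v x)) = (\<lambda>x. indicator E x * w x)"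
        using True E by (auto simp: w fun_eq_iff split: split_indicator)
      finally show ?thesis using True by simp
    qed simp
  qed
  finally show ?thesis by (simp add: ces_norm_def wlp_norm_def)
qed

section \<open>The pointwise inequality between the weights\<close>

text \<open>The norm is a power of a section integral over a measurable triangle. Measurability
  matters for the final estimate, because \<open>esssup\<close> of a non-measurable function is
  infinite by default.\<close>

lemma borel_measurable_lp_norm_initial:
  assumes q: "0 < q" and u[measurable]: "u \<in> borel_measurable halfline"
  shows "(\<lambda>x. lp_norm (ennreal q) {0<..<x} u) \<in> borel_measurable halfline"
proof -
  interpret sigma_finite_measure halfline by (rule sigma_finite_halfline)
  define Q where "Q = {z \<in> space (halfline \<Otimes>\<^sub>M halfline). snd z < fst z}"
  have [measurable]: "Q \<in> sets (halfline \<Otimes>\<^sub>M halfline)" unfolding Q_def by measurable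
  have eq: "lp_norm (ennreal q) {0<..<x} u
      = epowr (\<integral>\<^sup>+t. indicator Q (x, t) * epowr (u t) q \<partial>halfline) (1 / q)"
    if "x \<in> space halfline" for x
  proof -
    have "(\<integral>\<^sup>+t. epowr (u t) q \<partial>lebesgue_on {0<..<x})
        = (\<integral>\<^sup>+t. indicator {0<..<x} t * epowr (u t) q \<partial>halfline)"
      by (intro nn_integral_lebesgue_on_halfline) auto
    also have "\<dots> = (\<integral>\<^sup>+t. indicator Q (x, t) * epowr (u t) q \<partial>halfline)"
      using that by (intro nn_integral_cong) (auto simp: Q_def space_pair_measure split: split_indicator)
    finally show ?thesis using q by (simp add: lp_norm_eq)
  qed
  show ?thesis by (subst measurable_cong[OF eq]) measurable
qed

text \<open>For fixed \<open>t\<close>, the essential supremum gives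
  \<open>v x * K t / N x \<le> B\<close> for almost every \<open>x < t\<close>; letting
  \<open>t\<close> decrease to \<open>x\<close> replaces \<open>K t\<close> by
  \<open>K x\<close>.\<close>

lemma AE_weight_le:
  assumes q: "0 < q\<^sub>1" "0 < q\<^sub>2" and u\<^sub>1: "u\<^sub>1 \<in> omega_c (ennreal q\<^sub>1)" and u\<^sub>2: "u\<^sub>2 \<in> omega (ennreal q\<^sub>2)"
    and B: "\<And>t. 0 < t \<Longrightarrow> wlp_norm \<infinity> v {0<..<t} (\<lambda>x. inverse (lp_norm (ennreal q\<^sub>1) {0<..<x} u\<^sub>1))
        * lp_norm (ennreal q\<^sub>2) {t<..} u\<^sub>2 \<le> B"
  shows "AE x in halfline. v x * lp_norm (ennreal q\<^sub>2) {x<..} u\<^sub>2 \<le> B * lp_norm (ennreal q\<^sub>1) {0<..<x} u\<^sub>1"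
proof -
  define N where "N x = lp_norm (ennreal q\<^sub>1) {0<..<x} u\<^sub>1" for x
  define K where "K t = lp_norm (ennreal q\<^sub>2) {t<..} u\<^sub>2" for t
  have N: "0 < N x" "N x < top" if "0 < x" for x
    using u\<^sub>1 that by (auto simp: N_def omega_c_def)
  have K_mono: "K t \<le> K s" if "0 < s" "s \<le> t" for s t
    unfolding K_def using q that by (intro lp_norm_mono_set) auto
  \<comment> \<open>The exceptional set depends on \<open>t\<close>. Rational \<open>t\<close> give
    a single null set and are dense enough for the limit, since \<open>K\<close> is
    decreasing.\<close>
  have "AE x in halfline. \<forall>t\<in>\<rat> \<inter> {0<..}. x < t \<longrightarrow> inverse (N x) * v x * K t \<le> B"
  proof (rule AE_ball_countable')
    fix t :: real assume "t \<in> \<rat> \<inter> {0<..}"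
    then have t: "0 < t" by auto
    have "AE x in lebesgue_on {0<..<t}. inverse (N x) * v x
        \<le> wlp_norm \<infinity> v {0<..<t} (\<lambda>x. inverse (N x))"
      by (simp add: wlp_norm_def lp_norm_def esssup_AE)
    then have "AE x in halfline. x \<in> {0<..<t} \<longrightarrow> inverse (N x) * v x
        \<le> wlp_norm \<infinity> v {0<..<t} (\<lambda>x. inverse (N x))"
      by (subst (asm) AE_lebesgue_on_halfline) auto
    with AE_space show "AE x in halfline. x < t \<longrightarrow> inverse (N x) * v x * K t \<le> B"
    proof eventually_elim
      case (elim x)
      show ?case
      proof
        assume "x < t"
        with elim have "inverse (N x) * v x * K t \<le> wlp_norm \<infinity> v {0<..<t} (\<lambda>x. inverse (N x)) * K t"
          by (intro mult_right_mono) auto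
        also have "\<dots> \<le> B" using B[OF t] by (simp add: N_def K_def)
        finally show "inverse (N x) * v x * K t \<le> B" .
      qed
    qed
  qed (auto intro: countable_rat countable_Int1)
  with AE_space show ?thesis
  proof eventually_elim
    case (elim x)
    then have x: "0 < x" by simp
    have "inverse (N x) * v x * K x \<le> B"
      unfolding K_def
    proof (rule cmult_lp_norm_final_le_limit[OF q(2) _ _ x])
      show "u\<^sub>2 \<in> borel_measurable halfline" using u\<^sub>2 by (simp add: omega_def mplus_def)
      fix r assume "x < r"
      then obtain t where t: "t \<in> \<rat>" "x < t" "t < r" using Rats_dense_in_real by blast
      then have "inverse (N x) * v x * K r \<le> inverse (N x) * v x * K t"
        using x by (intro mult_left_mono K_mono) auto
      also have "\<dots> \<le> B" using elim t x by auto
      finally show "inverse (N x) * v x * lp_norm (ennreal q\<^sub>2) {r<..} u\<^sub>2 \<le> B"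
        by (simp add: K_def)
    qed
    then have "N x * (inverse (N x) * v x * K x) \<le> N x * B"
      by (intro mult_left_mono) auto
    then have "v x * K x \<le> B * N x"
      using N[OF x] by (simp add: mult.assoc[symmetric] ennreal_mult_inverse mult.commute[of B])
    then show ?case by (simp add: K_def N_def)
  qed
qed

text \<open>The test function supported on the exceptional set \<open>E\<close> turns admissibility
  of \<open>c\<close> into an upper bound for the integral of \<open>epowr (w x * K) p\<close> over
  \<open>E\<close>, which contradicts the definition of \<open>E\<close> unless \<open>E\<close> is
  null. The endpoints \<open>t\<close> and \<open>r\<close> are independent: the Cesaro estimate
  needs \<open>E\<close> below \<open>t\<close>, the Copson estimate needs it below
  \<open>r\<close>.\<close>

lemma AE_weight_le_admissible:
  assumes q: "0 < q\<^sub>1" "0 < q\<^sub>2" "0 < p" and v: "v\<^sub>1 \<in> weights" "v\<^sub>2 \<in> weights"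
    and u\<^sub>1: "u\<^sub>1 \<in> omega_c (ennreal q\<^sub>1)" and u\<^sub>2: "u\<^sub>2 \<in> omega (ennreal q\<^sub>2)"
    and adm: "\<forall>f\<in>fspace (cop_norm (ennreal p) (ennreal q\<^sub>1) u\<^sub>1 v\<^sub>1).
      ces_norm (ennreal p) (ennreal q\<^sub>2) u\<^sub>2 v\<^sub>2 f \<le> c * cop_norm (ennreal p) (ennreal q\<^sub>1) u\<^sub>1 v\<^sub>1 f"
    and c: "c < top" and t: "0 < t" and r: "0 < r"
  shows "AE x in halfline. x < t \<longrightarrow> x < r \<longrightarrow>
    inverse (v\<^sub>1 x) * v\<^sub>2 x * lp_norm (ennreal q\<^sub>2) {t<..} u\<^sub>2 \<le> c * lp_norm (ennreal q\<^sub>1) {0<..<r} u\<^sub>1"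
proof (rule ccontr)
  assume contr: "\<not> ?thesis"
  define w where "w = (\<lambda>x. inverse (v\<^sub>1 x) * v\<^sub>2 x)"
  define N where "N = lp_norm (ennreal q\<^sub>1) {0<..<r} u\<^sub>1"
  define K where "K = lp_norm (ennreal q\<^sub>2) {t<..} u\<^sub>2"
  have [measurable]: "v\<^sub>1 \<in> borel_measurable halfline" "v\<^sub>2 \<in> borel_measurable halfline"
    using v by (auto simp: weights_def mplus_def)
  have [measurable]: "w \<in> borel_measurable halfline" unfolding w_def by measurable
  have N: "N < top" using u\<^sub>1 r by (simp add: N_def omega_c_def)
  \<comment> \<open>Cutting at \<open>min t r\<close> serves both test function estimates and makes
    the measure of \<open>E\<close> finite.\<close>
  define E where "E = {x \<in> space halfline. x < min t r \<and> c * N < w x * K}"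
  have E[measurable]: "E \<in> sets halfline" unfolding E_def by measurable
  have E_sub: "E \<subseteq> {0<..<r}" "E \<subseteq> {0<..<t}" by (auto simp: E_def)
  have "emeasure halfline E \<le> emeasure halfline {0<..<r}"
    using E_sub by (intro emeasure_mono) (auto simp: sets_restrict_space_iff)
  also have "\<dots> = ennreal r"
    using r by (subst emeasure_restrict_space) auto
  finally have E_fin: "emeasure halfline E < top" by (simp add: order_le_less_trans)
  define f where "f = (\<lambda>x. indicator E x * inverse (v\<^sub>1 x))"
  have cop: "cop_norm (ennreal p) (ennreal q\<^sub>1) u\<^sub>1 v\<^sub>1 f \<le> epowr (emeasure halfline E) (1 / p) * N"
    unfolding f_def N_def using q E E_sub v u\<^sub>1
    by (intro cop_norm_test_function_le) (auto simp: weights_def omega_c_def)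
  also have "\<dots> < top"
    using E_fin N by (simp add: ennreal_mult_less_top)
  finally have f: "f \<in> fspace (cop_norm (ennreal p) (ennreal q\<^sub>1) u\<^sub>1 v\<^sub>1)"
    by (simp add: fspace_def mplus_def f_def)
  have "lp_norm (ennreal p) {0<..} (\<lambda>x. indicator E x * w x) * K \<le> ces_norm (ennreal p) (ennreal q\<^sub>2) u\<^sub>2 v\<^sub>2 f"
    unfolding f_def K_def using q E_sub t u\<^sub>2
    by (intro ces_norm_test_function_ge) (auto simp: omega_def w_def)
  also have "\<dots> \<le> c * cop_norm (ennreal p) (ennreal q\<^sub>1) u\<^sub>1 v\<^sub>1 f"
    using adm f by blast
  also have "\<dots> \<le> c * (epowr (emeasure halfline E) (1 / p) * N)"
    by (intro mult_left_mono cop) simp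
  finally have "epowr (lp_norm (ennreal p) {0<..} (\<lambda>x. indicator E x * w x) * K) p
      \<le> epowr (c * (epowr (emeasure halfline E) (1 / p) * N)) p"
    using q by (intro epowr_mono) auto
  then have "(\<integral>\<^sup>+x. indicator E x * epowr (w x) p \<partial>halfline) * epowr K p
      \<le> epowr (c * N) p * emeasure halfline E"
    using q by (simp add: epowr_mult epowr_lp_norm epowr_epowr mult_ac)
  then have "(\<integral>\<^sup>+x. indicator E x * epowr (w x * K) p \<partial>halfline) \<le> (\<integral>\<^sup>+x. epowr (c * N) p * indicator E x \<partial>halfline)"
    by (simp add: epowr_mult nn_integral_multc nn_integral_cmult flip: mult.assoc)
  \<comment> \<open>The integrands are strictly ordered on \<open>E\<close>, which is not null by
    \<open>contr\<close>. Strictness survives integration because the smaller integral is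
    finite.\<close>
  moreover have "(\<integral>\<^sup>+x. epowr (c * N) p * indicator E x \<partial>halfline) < (\<integral>\<^sup>+x. indicator E x * epowr (w x * K) p \<partial>halfline)"
  proof (rule nn_integral_less)
    show "(\<integral>\<^sup>+x. epowr (c * N) p * indicator E x \<partial>halfline) \<noteq> \<infinity>"
      using c N E_fin by (simp add: nn_integral_cmult ennreal_mult_eq_top_iff less_top[symmetric] ennreal_mult_less_top)
    show "AE x in halfline. epowr (c * N) p * indicator E x \<le> indicator E x * epowr (w x * K) p"
      using q by (auto simp: E_def intro!: epowr_mono split: split_indicator)
    show "\<not> (AE x in halfline. indicator E x * epowr (w x * K) p \<le> epowr (c * N) p * indicator E x)"
    proof
      assume "AE x in halfline. indicator E x * epowr (w x * K) p \<le> epowr (c * N) p * indicator E x"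
      with AE_space have "AE x in halfline. x < t \<longrightarrow> x < r \<longrightarrow> w x * K \<le> c * N"
      proof eventually_elim
        case (elim x)
        show ?case
        proof (intro impI)
          assume "x < t" "x < r"
          with elim q show "w x * K \<le> c * N"
            by (cases "x \<in> E") (auto simp: epowr_le_iff E_def not_less)
        qed
      qed
      with contr show False by (simp add: w_def K_def N_def)
    qed
  qed measurable
  ultimately show False by (simp add: not_less[symmetric])
qed

section \<open>Equality of the embedding constant and the supremum\<close>

theorem theorem7p10:
  fixes p q\<^sub>1 q\<^sub>2 :: ennreal
  assumes "0 < q\<^sub>1" and "q\<^sub>1 < p" and "p < q\<^sub>2" and "q\<^sub>2 < \<infinity>"
  shows "\<exists>c::real. c > 0 \<and>
    (\<forall>u\<^sub>1 u\<^sub>2 v\<^sub>1 v\<^sub>2 v :: real \<Rightarrow> ennreal.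
       v\<^sub>1 \<in> weights \<longrightarrow> v\<^sub>2 \<in> weights \<longrightarrow> u\<^sub>1 \<in> omega_c q\<^sub>1 \<longrightarrow> u\<^sub>2 \<in> omega q\<^sub>2 \<longrightarrow>
       v = (\<lambda>x. inverse (v\<^sub>1 x) * v\<^sub>2 x) \<longrightarrow>
       (let A = embedding_const (cop_norm p q\<^sub>1 u\<^sub>1 v\<^sub>1) (ces_norm p q\<^sub>2 u\<^sub>2 v\<^sub>2);
            B = (SUP t\<in>{0<..}.
                   wlp_norm \<infinity> v {0<..<t} (\<lambda>x. inverse (lp_norm q\<^sub>1 {0<..<x} u\<^sub>1))
                     * lp_norm q\<^sub>2 {t<..} u\<^sub>2)
        in ennreal (inverse c) * B \<le> A \<and> A \<le> ennreal c * B))"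
proof -
  obtain p' q\<^sub>1' q\<^sub>2' where eq: "p = ennreal p'" "q\<^sub>1 = ennreal q\<^sub>1'" "q\<^sub>2 = ennreal q\<^sub>2'"
    and q: "0 < q\<^sub>1'" "q\<^sub>1' < p'" "p' < q\<^sub>2'"
    using assms by (cases p; cases q\<^sub>1; cases q\<^sub>2) (auto simp: ennreal_less_iff)
  have "embedding_const (cop_norm p q\<^sub>1 u\<^sub>1 v\<^sub>1) (ces_norm p q\<^sub>2 u\<^sub>2 v\<^sub>2) =
      (SUP t\<in>{0<..}. wlp_norm \<infinity> v {0<..<t} (\<lambda>x. inverse (lp_norm q\<^sub>1 {0<..<x} u\<^sub>1)) * lp_norm q\<^sub>2 {t<..} u\<^sub>2)"
    (is "?A = ?B")
    if v: "v\<^sub>1 \<in> weights" "v\<^sub>2 \<in> weights" and u: "u\<^sub>1 \<in> omega_c q\<^sub>1" "u\<^sub>2 \<in> omega q\<^sub>2"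
      and v_def: "v = (\<lambda>x. inverse (v\<^sub>1 x) * v\<^sub>2 x)"
    for u\<^sub>1 u\<^sub>2 v\<^sub>1 v\<^sub>2 v :: "real \<Rightarrow> ennreal"
  proof (rule antisym)
    define N where "N x = lp_norm q\<^sub>1 {0<..<x} u\<^sub>1" for x
    define K where "K t = lp_norm q\<^sub>2 {t<..} u\<^sub>2" for t
    have u_meas[measurable]: "u\<^sub>1 \<in> borel_measurable halfline" "u\<^sub>2 \<in> borel_measurable halfline"
      using u by (auto simp: omega_def omega_c_def mplus_def)
    have v_meas[measurable]: "v\<^sub>1 \<in> borel_measurable halfline" "v\<^sub>2 \<in> borel_measurable halfline"
      using v by (auto simp: weights_def mplus_def)
    have N_meas[measurable]: "N \<in> borel_measurable halfline"
      unfolding N_def eq using q by (intro borel_measurable_lp_norm_initial) auto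
    have N: "0 < N x" "N x < top" if "0 < x" for x
      using u that by (auto simp: N_def omega_c_def)
    have K: "0 < K x" "K x < top" if "0 < x" for x
      using u that by (auto simp: K_def omega_def)
    show "?A \<le> ?B"
      unfolding embedding_const_def
    proof (rule Inf_lower, rule CollectI, rule ballI)
      fix f assume "f \<in> fspace (cop_norm p q\<^sub>1 u\<^sub>1 v\<^sub>1)"
      then have f: "f \<in> mplus" by (simp add: fspace_def)
      then have [measurable]: "f \<in> borel_measurable halfline" by (simp add: mplus_def)
      have "AE x in halfline. v x * K x \<le> ?B * N x"
        unfolding K_def N_def eq using q u
        by (intro AE_weight_le) (auto simp: eq intro!: SUP_upper)
      moreover have "AE x in halfline. 0 < v\<^sub>1 x \<and> v\<^sub>1 x < \<infinity>"
        using v by (simp add: weights_def)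
      ultimately have pointwise: "AE x in halfline. epowr (f x * v\<^sub>2 x) p' * epowr (K x) p'
          \<le> epowr ?B p' * (epowr (f x * v\<^sub>1 x) p' * epowr (N x) p')"
      proof eventually_elim
        case (elim x)
        have "v\<^sub>1 x * inverse (v\<^sub>1 x) = 1"
          using elim by (intro ennreal_mult_inverse) auto
        \<comment> \<open>Recovering \<open>v\<^sub>2\<close> from the quotient uses
          \<open>0 < v\<^sub>1 x < \<infinity>\<close>, which holds almost everywhere for a
          weight.\<close>
        then have "v\<^sub>2 x = v\<^sub>1 x * v x"
          by (simp add: v_def mult.assoc[symmetric])
        then have "f x * v\<^sub>2 x * K x = f x * v\<^sub>1 x * (v x * K x)" by (simp add: mult_ac)
        also have "\<dots> \<le> f x * v\<^sub>1 x * (?B * N x)" by (intro mult_left_mono elim) simp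
        also have "\<dots> = ?B * (f x * v\<^sub>1 x * N x)" by (simp add: mult_ac)
        finally have "epowr (f x * v\<^sub>2 x * K x) p' \<le> epowr (?B * (f x * v\<^sub>1 x * N x)) p'"
          using q by (intro epowr_mono) auto
        then show ?case by (simp add: epowr_mult)
      qed
      have "epowr (ces_norm p q\<^sub>2 u\<^sub>2 v\<^sub>2 f) p' \<le> (\<integral>\<^sup>+x. epowr (f x * v\<^sub>2 x) p' * epowr (K x) p' \<partial>halfline)"
        unfolding K_def eq using q u f v by (intro ces_norm_le) (auto simp: weights_def eq)
      also have "\<dots> \<le> (\<integral>\<^sup>+x. epowr ?B p' * (epowr (f x * v\<^sub>1 x) p' * epowr (N x) p') \<partial>halfline)"
        by (intro nn_integral_mono_AE pointwise)
      also have "\<dots> = epowr ?B p' * (\<integral>\<^sup>+x. epowr (f x * v\<^sub>1 x) p' * epowr (N x) p' \<partial>halfline)"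
        by (intro nn_integral_cmult) measurable
      also have "\<dots> \<le> epowr ?B p' * epowr (cop_norm p q\<^sub>1 u\<^sub>1 v\<^sub>1 f) p'"
        unfolding N_def eq using q u f v
        by (intro mult_left_mono cop_norm_ge) (auto simp: weights_def omega_c_def eq)
      finally show "ces_norm p q\<^sub>2 u\<^sub>2 v\<^sub>2 f \<le> ?B * cop_norm p q\<^sub>1 u\<^sub>1 v\<^sub>1 f"
        using q by (simp add: epowr_le_iff flip: epowr_mult)
    qed
    show "?B \<le> ?A"
      unfolding embedding_const_def
    proof (rule Inf_greatest)
      fix c assume "c \<in> {c. \<forall>f\<in>fspace (cop_norm p q\<^sub>1 u\<^sub>1 v\<^sub>1). ces_norm p q\<^sub>2 u\<^sub>2 v\<^sub>2 f \<le> c * cop_norm p q\<^sub>1 u\<^sub>1 v\<^sub>1 f}"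
      then have adm: "\<forall>f\<in>fspace (cop_norm p q\<^sub>1 u\<^sub>1 v\<^sub>1). ces_norm p q\<^sub>2 u\<^sub>2 v\<^sub>2 f \<le> c * cop_norm p q\<^sub>1 u\<^sub>1 v\<^sub>1 f"
        by simp
      show "?B \<le> c"
      proof (cases "c = top")
        case False
        then have c: "c < top" by (simp add: less_top)
        show ?thesis
        proof (rule SUP_least)
          fix t :: real assume "t \<in> {0<..}"
          then have t: "0 < t" by simp
          \<comment> \<open>Here \<open>t\<close> is fixed by the supremum and only \<open>r\<close>
            has to tend to \<open>x\<close>; rational \<open>r\<close> again yield a common null
            set.\<close>
          have "AE x in halfline. \<forall>r\<in>\<rat> \<inter> {0<..}. x < t \<longrightarrow> x < r \<longrightarrow> v x * K t \<le> c * N r"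
            unfolding v_def K_def N_def eq using q u v adm c t
            by (intro AE_ball_countable' AE_weight_le_admissible[where p = p'])
              (auto simp: eq intro: countable_rat countable_Int1)
          \<comment> \<open>Dividing by \<open>K t\<close>, which is positive and finite, leaves a
            bound independent of \<open>x\<close>, as an estimate of the essential supremum over
            \<open>(0, t)\<close> requires. Multiplying by \<open>K t\<close> afterwards returns
            \<open>c\<close>.\<close>
          with AE_space have "AE x in halfline. x \<in> {0<..<t} \<longrightarrow> inverse (N x) * v x \<le> c / K t"
          proof eventually_elim
            case (elim x)
            show ?case
            proof
              assume "x \<in> {0<..<t}"
              then have x: "0 < x" "x < t" by auto
              have "v x * K t \<le> c * N x"
                unfolding N_def eq
              proof (rule le_cmult_lp_norm_initial_limit[OF _ u_meas(1) _ c _ x(1)])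
                show "0 < q\<^sub>1'" using q by simp
                show "lp_norm (ennreal q\<^sub>1') {0<..<r} u\<^sub>1 < top" if "0 < r" for r
                  using N[OF that] by (simp add: N_def eq)
                fix r assume "x < r"
                then obtain s where s: "s \<in> \<rat>" "x < s" "s < r" using Rats_dense_in_real by blast
                then have "v x * K t \<le> c * N s" using elim x by auto
                also have "\<dots> \<le> c * N r"
                  unfolding N_def eq using s q by (intro mult_left_mono lp_norm_mono_set) auto
                finally show "v x * K t \<le> c * lp_norm (ennreal q\<^sub>1') {0<..<r} u\<^sub>1"
                  by (simp add: N_def eq)
              qed
              then have "inverse (N x) * (v x * K t) * inverse (K t) \<le> inverse (N x) * (c * N x) * inverse (K t)"
                by (intro mult_left_mono mult_right_mono) auto
              moreover have "inverse (N x) * (v x * K t) * inverse (K t) = inverse (N x) * v x * (K t * inverse (K t))"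
                by (simp add: mult_ac)
              moreover have "inverse (N x) * (c * N x) * inverse (K t) = c * (N x * inverse (N x)) * inverse (K t)"
                by (simp add: mult_ac)
              ultimately show "inverse (N x) * v x \<le> c / K t"
                using N[OF x(1)] K[OF t] by (simp add: ennreal_mult_inverse divide_ennreal_def)
            qed
          qed
          then have "AE x in lebesgue_on {0<..<t}. inverse (N x) * v x \<le> c / K t"
            by (subst AE_lebesgue_on_halfline) auto
          moreover have "(\<lambda>x. inverse (N x) * v x) \<in> borel_measurable (lebesgue_on {0<..<t})"
            by (rule borel_measurable_lebesgue_on_halfline) (auto simp: v_def)
          ultimately have "esssup (lebesgue_on {0<..<t}) (\<lambda>x. inverse (N x) * v x) \<le> c / K t"
            by (rule esssup_I[rotated])
          then have "esssup (lebesgue_on {0<..<t}) (\<lambda>x. inverse (N x) * v x) * K t \<le> c / K t * K t"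
            by (rule mult_right_mono) simp
          also have "\<dots> = c"
            using K[OF t] by (simp add: ennreal_divide_times mult_divide_eq_ennreal)
          finally show "wlp_norm \<infinity> v {0<..<t} (\<lambda>x. inverse (lp_norm q\<^sub>1 {0<..<x} u\<^sub>1)) * lp_norm q\<^sub>2 {t<..} u\<^sub>2 \<le> c"
            by (simp add: wlp_norm_def lp_norm_def[of top] N_def K_def)
        qed
      qed simp
    qed
  qed
  \<comment> \<open>Since the two quantities coincide, the constant 1 works for all weights at
    once.\<close>
  then show ?thesis
    by (intro exI[of _ 1]) (auto simp: Let_def)
qed

end
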